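(* Let $C \subsetneq \mathbb{R}^d$ be a closed convex cone with $0 \in C$ and let $X, Y \colon \Omega \to \mathbb{R}^d$ be random variables. The lower $C$-quantile function $Q^-_{X,C}$ has the following properties. (a) The function $p \mapsto Q^-_{X,C}(p)$ has closed convex values and satisfies $Q^-_{X,C}(p) \oplus C = Q^-_{X,C}(p)$ for all $p \in [0,1]$. In particular, $Q^-_{X,C}(p)$ is a connected set for each $p \in [0,1]$. (b) For all $b \in \mathbb{R}^d$ and all invertible matrices $A \in \mathbb{R}^{d\times d}$ it holds $Q^-_{AX+b,\,AC}(p) = A\,Q^-_{X,C}(p) + b$ for all $p \in [0,1]$. (c) If $p_1, p_2 \in [0,1]$ and $p_1 \geq p_2$, then $Q^-_{X,C}(p_1) \subseteq Q^-_{X,C}(p_2)$. (d) If $X \leq_C Y$ (almost surely), then $Q^-_{X,C}(p) \supseteq Q^-_{Y,C}(p)$ for all $p \in [0,1]$.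
   Context: $(\Omega,\mathcal{F},P)$ is a probability space; random variables $\Omega \to \mathbb{R}^d$ are Borel measurable maps. A cone is a set $C \subseteq \mathbb{R}^d$ with $sz \in C$ for all $s>0$, $z \in C$. $z \leq_C z'$ means $z'-z \in C$; for random variables $X \leq_C Y$ is understood almost surely. The dual cone is $C^+ = \{w \in \mathbb{R}^d \mid w^Tz \geq 0 \text{ for all } z \in C\}$; for $w \in \mathbb{R}^d\setminus\{0\}$, $H^+(w) = \{z \mid w^Tz \geq 0\}$. For $w \in C^+\setminus\{0\}$, $F_{X,w}(z) = P(X \in z - H^+(w)) = P(w^TX \leq w^Tz)$, and $F_{X,C}(z) = \inf_{w \in C^+\setminus\{0\}} F_{X,w}(z)$. The lower $C$-quantile function of $X$ is $Q^-_{X,C}(p) = \{z \in \mathbb{R}^d \mid F_{X,C}(z) \geq p\}$ for $p \in [0,1]$ (a possibly empty set). For an invertible matrix $A$, $AC = \{Az \mid z \in C\}$ and $Q^-_{AX+b,AC}$ is the lower quantile function of $AX+b$ with respect to the cone $AC$. For sets $A, B \subseteq \mathbb{R}^d$, $A \oplus B = \operatorname{cl}(A+B)$ is the closure of the Minkowski sum, with $\emptyset + B = \emptyset$. *)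

theory Defs
  imports "HOL-Probability.Probability" "HOL-Library.Set_Algebras"
begin

text \<open>Sums of sets are Minkowski sums, \<open>+\<close> of \<open>HOL-Library.Set_Algebras\<close>.\<close>

text \<open>
  The library constant \<^const>\<open>cone\<close> also closes under multiplication by \<open>0\<close>;
  here only positive multiples are required, so a cone need not contain \<open>0\<close>.
\<close>
definition pos_cone :: "(real^'n) set \<Rightarrow> bool" where
  "pos_cone C \<longleftrightarrow> (\<forall>s>0. \<forall>z\<in>C. s *\<^sub>R z \<in> C)"

definition cone_le :: "(real^'n) set \<Rightarrow> real^'n \<Rightarrow> real^'n \<Rightarrow> bool" where
  "cone_le C z z' \<longleftrightarrow> z' - z \<in> C"

definition dual_cone :: "(real^'n) set \<Rightarrow> (real^'n) set" where
  "dual_cone C = {w. \<forall>z\<in>C. w \<bullet> z \<ge> 0}"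

definition halfspace :: "real^'n \<Rightarrow> (real^'n) set" where
  "halfspace w = {z. w \<bullet> z \<ge> 0}"

text \<open>
  The set \<open>z - H\<^sup>+(w)\<close> is written as an image, since \<open>-\<close> on sets is set difference.
\<close>
definition F_dir :: "'a measure \<Rightarrow> ('a \<Rightarrow> real^'n) \<Rightarrow> real^'n \<Rightarrow> real^'n \<Rightarrow> real" where
  "F_dir M X w z = measure M {\<omega> \<in> space M. X \<omega> \<in> (\<lambda>h. z - h) ` halfspace w}"

lemma F_dir_eq: "F_dir M X w z = measure M {\<omega> \<in> space M. w \<bullet> X \<omega> \<le> w \<bullet> z}"
proof -
  have "x \<in> (\<lambda>h. z - h) ` halfspace w \<longleftrightarrow> w \<bullet> x \<le> w \<bullet> z" for x
  proof
    assume "w \<bullet> x \<le> w \<bullet> z"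
    then have "z - x \<in> halfspace w" by (simp add: halfspace_def inner_diff_right)
    moreover have "x = z - (z - x)" by simp
    ultimately show "x \<in> (\<lambda>h. z - h) ` halfspace w" by (rule rev_image_eqI)
  qed (auto simp: halfspace_def inner_diff_right)
  then show ?thesis by (simp add: F_dir_def)
qed

text \<open>
  The infimum is taken in the reals. It is the genuine infimum whenever \<open>C\<close> is a proper closed
  convex cone: then \<open>dual_cone C - {0}\<close> is nonempty, and the values are bounded below by \<open>0\<close>.
\<close>
definition F_cone :: "'a measure \<Rightarrow> ('a \<Rightarrow> real^'n) \<Rightarrow> (real^'n) set \<Rightarrow> real^'n \<Rightarrow> real" where
  "F_cone M X C z = (INF w \<in> dual_cone C - {0}. F_dir M X w z)"

definition lower_quantile ::
  "'a measure \<Rightarrow> ('a \<Rightarrow> real^'n) \<Rightarrow> (real^'n) set \<Rightarrow> real \<Rightarrow> (real^'n) set" where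
  "lower_quantile M X C p = {z. F_cone M X C z \<ge> p}"

definition closed_sum :: "(real^'n) set \<Rightarrow> (real^'n) set \<Rightarrow> (real^'n) set" (infixl "\<oplus>\<^sub>c\<^sub>l" 65) where
  "A \<oplus>\<^sub>c\<^sub>l B = closure (A + B)"

end

theory Submission
  imports Defs
begin

text \<open>
  \<open>Q\<^sup>-\<close> is the intersection over \<open>w \<in> C\<^sup>+ - {0}\<close> of the sets of all \<open>z\<close> at whose
  projection \<open>w\<^sup>Tz\<close> the distribution function of \<open>w\<^sup>TX\<close> is at least \<open>p\<close>. As distribution
  functions are increasing and right-continuous, each of these sets is empty, a closed halfspace
  with inner normal \<open>w\<close>, or everything. This gives (a); (b) follows from
  \<open>w\<^sup>T(Ax + b) = (A\<^sup>Tw)\<^sup>Tx + w\<^sup>Tb\<close>, and (d) from \<open>w\<^sup>TX \<le> w\<^sup>TY\<close> almost surely.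
\<close>

text \<open>A hyperplane strictly separating a point from \<open>C\<close> has its normal in the
  dual cone. This makes the index set of the infimum in \<open>F_cone\<close> nonempty.\<close>

lemma dual_cone_nontrivial:
  fixes C :: "(real^'n) set"
  assumes "closed C" "convex C" "pos_cone C" "0 \<in> C" "C \<noteq> UNIV"
  shows "dual_cone C - {0} \<noteq> {}"
proof -
  from assms(5) obtain z where "z \<notin> C" by blast
  with assms(1,2) obtain a b where ab: "a \<bullet> z < b" "\<And>x. x \<in> C \<Longrightarrow> b < a \<bullet> x"
    using separating_hyperplane_closed_point[of C z] by blast
  have "b < 0" using ab(2)[OF assms(4)] by simp
  have "a \<bullet> x \<ge> 0" if "x \<in> C" for x
  proof (rule ccontr)
    assume neg: "\<not> a \<bullet> x \<ge> 0"
    \<comment> \<open>The factor \<open>b / (a \<bullet> x)\<close> scales \<open>x\<close> to a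
      point of \<open>C\<close> at which \<open>a\<close> takes the value \<open>b\<close> exactly,
      whereas it exceeds \<open>b\<close> on all of \<open>C\<close>.\<close>
    then have "b / (a \<bullet> x) > 0"
      using \<open>b < 0\<close> by (simp add: divide_neg_neg)
    then have "(b / (a \<bullet> x)) *\<^sub>R x \<in> C"
      using assms(3) that by (simp add: pos_cone_def)
    from ab(2)[OF this] neg show False by simp
  qed
  moreover have "a \<noteq> 0" using ab(1) \<open>b < 0\<close> by auto
  ultimately show ?thesis by (auto simp: dual_cone_def)
qed

text \<open>Over a nonempty index set, with values bounded below by \<open>0\<close>, a real infimum
  is at least \<open>p\<close> iff every value is. Closedness, convexity and monotonicity can then
  be checked for one \<open>w\<close> at a time.\<close>

lemma lower_quantile_eq_INT:
  assumes "dual_cone C - {0} \<noteq> {}"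
  shows "lower_quantile M X C p = (\<Inter>w\<in>dual_cone C - {0}. {z. p \<le> F_dir M X w z})"
proof -
  have "bdd_below ((\<lambda>w. F_dir M X w z) ` (dual_cone C - {0}))" for z
    by (rule bdd_belowI[of _ 0]) (auto simp: F_dir_def)
  then show ?thesis
    using assms by (auto simp: lower_quantile_def F_cone_def le_cINF_iff)
qed

lemma F_dir_eq_cdf:
  assumes "X \<in> borel_measurable M"
  shows "F_dir M X w z = cdf (distr M borel (\<lambda>\<omega>. w \<bullet> X \<omega>)) (w \<bullet> z)"
proof -
  have "(\<lambda>\<omega>. w \<bullet> X \<omega>) \<in> borel_measurable M" using assms by measurable
  moreover have "(\<lambda>\<omega>. w \<bullet> X \<omega>) -` {..w \<bullet> z} \<inter> space M = {\<omega> \<in> space M. w \<bullet> X \<omega> \<le> w \<bullet> z}"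
    by auto
  ultimately show ?thesis by (simp add: F_dir_eq cdf_def measure_distr)
qed

text \<open>The complement is open: where \<open>G t < p\<close>, monotonicity keeps
  \<open>G\<close> below \<open>p\<close> to the left of \<open>t\<close>, and right-continuity does
  so on a short interval to the right.\<close>

lemma closed_superlevel_mono_right_cont:
  fixes G :: "real \<Rightarrow> real"
  assumes "mono G" and rc: "\<And>t. continuous (at_right t) G"
  shows "closed {t. p \<le> G t}"
proof -
  have "\<exists>e>0. \<forall>s. dist s t < e \<longrightarrow> G s < p" if "G t < p" for t
  proof -
    have "(G \<longlongrightarrow> G t) (at_right t)" using rc[of t] by (simp add: continuous_within)
    then have "eventually (\<lambda>s. G s < p) (at_right t)"
      using that by (rule order_tendstoD)
    then obtain b where b: "b > t" "\<And>s. t < s \<Longrightarrow> s < b \<Longrightarrow> G s < p"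
      by (auto simp: eventually_at_right_field)
    have "G s < p" if "dist s t < b - t" for s
    proof (cases "s \<le> t")
      case True
      then show ?thesis using \<open>mono G\<close> \<open>G t < p\<close> by (meson monoD le_less_trans)
    next
      case False
      then show ?thesis using b(2)[of s] that by (simp add: dist_real_def)
    qed
    with b(1) show ?thesis by (intro exI[of _ "b - t"]) simp
  qed
  then have "open (- {t. p \<le> G t})" by (auto simp: open_dist not_le)
  then show ?thesis by (simp add: closed_def)
qed

context prob_space
begin

lemma mono_cdf_distr:
  assumes "Z \<in> borel_measurable M"
  shows "mono (cdf (distr M borel Z))"
proof -
  interpret D: real_distribution "distr M borel Z"
    using assms by (rule real_distribution_distr)
  show ?thesis by (simp add: mono_def D.cdf_nondecreasing)
qed

lemma closed_superlevel_F_dir: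
  assumes [measurable]: "X \<in> borel_measurable M"
  shows "closed {z. p \<le> F_dir M X w z}"
proof -
  let ?D = "distr M borel (\<lambda>\<omega>. w \<bullet> X \<omega>)"
  interpret D: real_distribution ?D
    by (rule real_distribution_distr) measurable
  have "closed {t. p \<le> cdf ?D t}"
    by (rule closed_superlevel_mono_right_cont[OF mono_cdf_distr D.cdf_is_right_cont]) measurable
  then have "closed ((\<lambda>z. w \<bullet> z) -` {t. p \<le> cdf ?D t})"
    by (rule closed_vimage) (intro continuous_intros)
  then show ?thesis by (simp add: vimage_def F_dir_eq_cdf)
qed

lemma F_dir_mono:
  assumes [measurable]: "X \<in> borel_measurable M" and "w \<bullet> z \<le> w \<bullet> z'"
  shows "F_dir M X w z \<le> F_dir M X w z'"
  using assms by (auto simp: F_dir_eq intro!: finite_measure_mono)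

text \<open>A superlevel set of an increasing function on the line is an interval, and its preimage
  under the linear map \<open>z \<mapsto> w \<bullet> z\<close> is convex.\<close>

lemma convex_superlevel_F_dir:
  assumes [measurable]: "X \<in> borel_measurable M"
  shows "convex {z. p \<le> F_dir M X w z}"
proof -
  let ?G = "cdf (distr M borel (\<lambda>\<omega>. w \<bullet> X \<omega>))"
  have "mono ?G" by (rule mono_cdf_distr) measurable
  then have "is_interval {t. p \<le> ?G t}"
    by (auto simp: is_interval_1 dest: monoD intro: order_trans)
  then have "convex ((\<lambda>z. w \<bullet> z) -` {t. p \<le> ?G t})"
    by (intro convex_linear_vimage is_interval_convex)
       (auto intro: bounded_linear.linear bounded_linear_inner_right)
  then show ?thesis by (simp add: vimage_def F_dir_eq_cdf)
qed

text \<open>Pairing \<open>Y - X \<in> C\<close> with \<open>w\<close> in the dual cone gives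
  \<open>w \<bullet> X \<le> w \<bullet> Y\<close> almost surely, so up to a null set the event for
  \<open>Y\<close> lies in the event for \<open>X\<close>.\<close>

lemma F_dir_antimono_cone_le:
  assumes [measurable]: "X \<in> borel_measurable M" "Y \<in> borel_measurable M"
    and "w \<in> dual_cone C" and "AE \<omega> in M. cone_le C (X \<omega>) (Y \<omega>)"
  shows "F_dir M Y w z \<le> F_dir M X w z"
  unfolding F_dir_eq
proof (rule finite_measure_mono_AE)
  show "AE \<omega> in M. \<omega> \<in> {\<omega> \<in> space M. w \<bullet> Y \<omega> \<le> w \<bullet> z} \<longrightarrow>
      \<omega> \<in> {\<omega> \<in> space M. w \<bullet> X \<omega> \<le> w \<bullet> z}"
    using assms(4)
  proof eventually_elim
    case (elim \<omega>)
    then have "w \<bullet> X \<omega> \<le> w \<bullet> Y \<omega>"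
      using assms(3) by (auto simp: dual_cone_def cone_le_def inner_diff_right)
    then show ?case by auto
  qed
qed measurable

lemma lower_quantile_antimono_cone_le:
  assumes "X \<in> borel_measurable M" "Y \<in> borel_measurable M"
    and "dual_cone C - {0} \<noteq> {}" and "AE \<omega> in M. cone_le C (X \<omega>) (Y \<omega>)"
  shows "lower_quantile M Y C p \<subseteq> lower_quantile M X C p"
  unfolding lower_quantile_eq_INT[OF assms(3)]
  using F_dir_antimono_cone_le[OF assms(1,2) _ assms(4)] by (auto intro: order_trans)

lemma closed_lower_quantile:
  assumes "X \<in> borel_measurable M" "dual_cone C - {0} \<noteq> {}"
  shows "closed (lower_quantile M X C p)"
  unfolding lower_quantile_eq_INT[OF assms(2)]
  using closed_superlevel_F_dir[OF assms(1)] by blast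

lemma convex_lower_quantile:
  assumes "X \<in> borel_measurable M" "dual_cone C - {0} \<noteq> {}"
  shows "convex (lower_quantile M X C p)"
  unfolding lower_quantile_eq_INT[OF assms(2)]
  by (intro convex_INT convex_superlevel_F_dir assms(1))

text \<open>Adding \<open>c \<in> C\<close> cannot decrease \<open>w \<bullet> z\<close> for
  \<open>w\<close> in the dual cone, which gives one inclusion; \<open>0 \<in> C\<close> gives the
  other.\<close>

lemma lower_quantile_plus_cone:
  assumes "X \<in> borel_measurable M" "dual_cone C - {0} \<noteq> {}" "0 \<in> C"
  shows "lower_quantile M X C p + C = lower_quantile M X C p"
proof
  have "p \<le> F_dir M X w (z + c)" if "p \<le> F_dir M X w z" "w \<in> dual_cone C" "c \<in> C" for w z c
    using that(1)
  proof (rule order_trans)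
    show "F_dir M X w z \<le> F_dir M X w (z + c)"
      using that(2,3) by (intro F_dir_mono assms(1)) (simp add: dual_cone_def inner_add_right)
  qed
  then show "lower_quantile M X C p + C \<subseteq> lower_quantile M X C p"
    unfolding lower_quantile_eq_INT[OF assms(2)] by (auto elim!: set_plus_elim)
  show "lower_quantile M X C p \<subseteq> lower_quantile M X C p + C"
  proof
    fix z assume "z \<in> lower_quantile M X C p"
    then have "z + 0 \<in> lower_quantile M X C p + C" using assms(3) by (rule set_plus_intro)
    then show "z \<in> lower_quantile M X C p + C" by simp
  qed
qed

end

lemma dual_cone_linear_image:
  fixes A :: "real^'n^'n"
  shows "w \<in> dual_cone ((\<lambda>z. A *v z) ` C) \<longleftrightarrow> transpose A *v w \<in> dual_cone C"
  by (simp add: dual_cone_def dot_lmul_matrix)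

text \<open>The transpose of \<open>A\<close> carries the dual cone of \<open>AC\<close> onto that
  of \<open>C\<close>, and being invertible it sends only \<open>0\<close> to \<open>0\<close>. This
  is the change of index for the infimum in \<open>F_cone\<close>.\<close>

lemma image_transpose_dual_cone:
  fixes A :: "real^'n^'n"
  assumes "invertible A"
  shows "(\<lambda>w. transpose A *v w) ` (dual_cone ((\<lambda>z. A *v z) ` C) - {0}) = dual_cone C - {0}"
proof -
  obtain B where "transpose A ** B = mat 1" "B ** transpose A = mat 1"
    using transpose_invertible[OF assms] unfolding invertible_def by blast
  then have inv: "transpose A *v (B *v v) = v" and inv': "B *v (transpose A *v v) = v" for v
    by (simp_all only: matrix_vector_mul_assoc matrix_vector_mul_lid)
  have "transpose A *v w \<noteq> 0" if "w \<noteq> 0" for w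
    using that inv'[of w] by (metis matrix_vector_mult_0_right)
  moreover have "v \<in> (\<lambda>w. transpose A *v w) ` (dual_cone ((\<lambda>z. A *v z) ` C) - {0})"
    if "v \<in> dual_cone C - {0}" for v
  proof (rule image_eqI[of _ _ "B *v v"])
    show "v = transpose A *v (B *v v)" by (simp only: inv)
    show "B *v v \<in> dual_cone ((\<lambda>z. A *v z) ` C) - {0}"
      using that inv[of v] by (metis DiffE DiffI dual_cone_linear_image insertI1 singletonD
          matrix_vector_mult_0_right)
  qed
  ultimately show ?thesis by (auto simp only: dual_cone_linear_image Diff_iff singleton_iff)
qed

text \<open>Moving \<open>A\<close> to the other side of the inner product leaves the term
  \<open>w \<bullet> b\<close> on both sides of the inequality, where it cancels.\<close>

lemma F_dir_affine:
  fixes A :: "real^'n^'n"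
  shows "F_dir M (\<lambda>\<omega>. A *v X \<omega> + b) w (A *v y + b) = F_dir M X (transpose A *v w) y"
  by (simp add: F_dir_eq inner_add_right dot_lmul_matrix)

lemma lower_quantile_affine:
  fixes A :: "real^'n^'n"
  assumes "invertible A"
  shows "lower_quantile M (\<lambda>\<omega>. A *v X \<omega> + b) ((\<lambda>z. A *v z) ` C) p
    = (\<lambda>z. A *v z + b) ` lower_quantile M X C p"
proof -
  \<comment> \<open>Substituting \<open>transpose A *v w\<close> for the direction turns the infimum
    for \<open>C\<close> into the one for \<open>AC\<close>.\<close>
  have F: "F_cone M (\<lambda>\<omega>. A *v X \<omega> + b) ((\<lambda>z. A *v z) ` C) (A *v y + b) = F_cone M X C y" for y
    unfolding F_cone_def F_dir_affine image_transpose_dual_cone[OF assms, of C, symmetric]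
    by (simp only: image_image)
  obtain B where "A ** B = mat 1"
    using assms unfolding invertible_def by blast
  \<comment> \<open>Every point is of the form \<open>A *v y + b\<close>, so \<open>F\<close>
    determines the transformed \<open>F_cone\<close> everywhere.\<close>
  then have "z = A *v (B *v (z - b)) + b" for z
    by (simp add: matrix_vector_mul_assoc)
  then show ?thesis
    by (auto simp: lower_quantile_def F set_eq_iff image_iff) (metis F)+
qed

theorem proposition3p7:
  fixes M :: "'a measure"
    and X Y :: "'a \<Rightarrow> real^'n"
    and C :: "(real^'n) set"
  assumes "prob_space M"
    and "X \<in> borel_measurable M"
    and "Y \<in> borel_measurable M"
    and "closed C" and "convex C" and "pos_cone C" and "0 \<in> C" and "C \<noteq> UNIV"
  shows "(\<forall>p\<in>{0..1}.
            closed (lower_quantile M X C p) \<and>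
            convex (lower_quantile M X C p) \<and>
            lower_quantile M X C p \<oplus>\<^sub>c\<^sub>l C = lower_quantile M X C p \<and>
            connected (lower_quantile M X C p))
       \<and> (\<forall>(b :: real^'n) (A :: real^'n^'n). invertible A \<longrightarrow>
            (\<forall>p\<in>{0..1}.
              lower_quantile M (\<lambda>\<omega>. A *v X \<omega> + b) ((\<lambda>z. A *v z) ` C) p
                = (\<lambda>z. A *v z + b) ` lower_quantile M X C p))
       \<and> (\<forall>p1\<in>{0..1}. \<forall>p2\<in>{0..1}. p1 \<ge> p2 \<longrightarrow>
            lower_quantile M X C p1 \<subseteq> lower_quantile M X C p2)
       \<and> ((AE \<omega> in M. cone_le C (X \<omega>) (Y \<omega>)) \<longrightarrow>
            (\<forall>p\<in>{0..1}. lower_quantile M X C p \<supseteq> lower_quantile M Y C p))"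
proof -
  interpret prob_space M by fact
  note nontriv = dual_cone_nontrivial[OF assms(4-8)]
  note conv = convex_lower_quantile[OF assms(2) nontriv]
  \<comment> \<open>The Minkowski sum with \<open>C\<close> is the quantile set itself, which is
    closed, so the closure in \<open>closed_sum\<close> adds nothing.\<close>
  have "closed (lower_quantile M X C p) \<and> convex (lower_quantile M X C p) \<and>
      lower_quantile M X C p \<oplus>\<^sub>c\<^sub>l C = lower_quantile M X C p \<and>
      connected (lower_quantile M X C p)" for p
    using closed_lower_quantile[OF assms(2) nontriv] conv convex_connected[OF conv]
    by (simp add: closed_sum_def lower_quantile_plus_cone[OF assms(2) nontriv assms(7)])
  moreover have "lower_quantile M X C p1 \<subseteq> lower_quantile M X C p2" if "p1 \<ge> p2" for p1 p2
    using that by (auto simp: lower_quantile_def)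
  ultimately show ?thesis
    using lower_quantile_affine lower_quantile_antimono_cone_le[OF assms(2,3) nontriv]
    by blast
qed

end
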